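(* Let $\Gamma$ be a random edge-labelled graph on $n$ vertices with label probabilities $p_m=p_m(n)$, and let $p_B=\sum_{m=4}^\infty p_m$. If $n^3p_B^2\to0$, $n^3p_Bp_3\to0$, and $n^5p_3^4\to0$ as $n\to\infty$, then $W_\Gamma$ is asymptotically almost surely of FC-type.
   Context: Random edge-labelled graph: for each $n$, nonnegative numbers $p_m(n)$ ($m=2,3,4,\dots$) are given with $\sum_{m=2}^\infty p_m(n)\le 1$. On a vertex set of size $n$, independently for each pair of vertices, the pair is joined by an edge labelled $m$ with probability $p_m(n)$ for each integer $m\ge2$, and is not joined by an edge with the remaining probability. "Asymptotically almost surely" means with probability tending to $1$ as $n\to\infty$. Coxeter group: if $\Gamma$ has vertices $v_1,\dots,v_n$ and the edge between $v_i$ and $v_j$ (if present) has label $m_{i,j}$, then $W_\Gamma=\langle v_1,\dots,v_n\mid v_i^2,\ (v_iv_j)^{m_{i,j}}\rangle$, with the second type of relator only for adjacent pairs. $W_\Gamma$ is of FC-type if the vertex set of every clique (complete subgraph) in $\Gamma$ generates a finite subgroup of $W_\Gamma$. *)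

theory Defs
  imports "HOL-Probability.Probability" "HOL-Algebra.Generated_Groups"
begin

section \<open>Groups given by generators and relators\<close>

text \<open>
  A word over an alphabet is a list of letters \<open>(x, b)\<close>; the letter \<open>(x, True)\<close> stands for the
  generator \<open>x\<close> and \<open>(x, False)\<close> for its formal inverse.
\<close>

type_synonym 'a word = "('a \<times> bool) list"

definition words :: "'a set \<Rightarrow> 'a word set" where
  "words X = lists (X \<times> UNIV)"

inductive pres_eq :: "'a set \<Rightarrow> 'a word set \<Rightarrow> 'a word \<Rightarrow> 'a word \<Rightarrow> bool" for X R where
  refl: "w \<in> words X \<Longrightarrow> pres_eq X R w w"
| sym: "pres_eq X R v w \<Longrightarrow> pres_eq X R w v"
| trans: "pres_eq X R u v \<Longrightarrow> pres_eq X R v w \<Longrightarrow> pres_eq X R u w"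
| cancel: "u \<in> words X \<Longrightarrow> v \<in> words X \<Longrightarrow> x \<in> X \<Longrightarrow>
    pres_eq X R (u @ [(x, b), (x, \<not> b)] @ v) (u @ v)"
| relator: "u \<in> words X \<Longrightarrow> v \<in> words X \<Longrightarrow> r \<in> R \<Longrightarrow> r \<in> words X \<Longrightarrow>
    pres_eq X R (u @ r @ v) (u @ v)"

definition pres_rel :: "'a set \<Rightarrow> 'a word set \<Rightarrow> ('a word \<times> 'a word) set" where
  "pres_rel X R = {(v, w). pres_eq X R v w}"

definition presented_group :: "'a set \<Rightarrow> 'a word set \<Rightarrow> 'a word set monoid" where
  "presented_group X R =
    \<lparr>carrier = words X // pres_rel X R,
     monoid.mult = (\<lambda>A B. \<Union>u\<in>A. \<Union>v\<in>B. pres_rel X R `` {u @ v}),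
     one = pres_rel X R `` {[]}\<rparr>"

definition pres_gen :: "'a set \<Rightarrow> 'a word set \<Rightarrow> 'a \<Rightarrow> 'a word set" where
  "pres_gen X R x = pres_rel X R `` {[(x, True)]}"

lemma words_simps [simp]:
  "[] \<in> words X"
  "(a # w) \<in> words X \<longleftrightarrow> fst a \<in> X \<and> w \<in> words X"
  "(v @ w) \<in> words X \<longleftrightarrow> v \<in> words X \<and> w \<in> words X"
  by (cases a; auto simp: words_def)+

lemma pres_eq_words: "pres_eq X R v w \<Longrightarrow> v \<in> words X \<and> w \<in> words X"
  by (induction rule: pres_eq.induct) auto

lemma equiv_pres_rel: "equiv (words X) (pres_rel X R)"
proof (rule equivI)
  show "pres_rel X R \<subseteq> words X \<times> words X"
    by (auto simp: pres_rel_def dest: pres_eq_words)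
  show "refl_on (words X) (pres_rel X R)"
    by (auto simp: refl_on_def pres_rel_def intro: pres_eq.refl)
  show "Relation.sym (pres_rel X R)"
    by (auto simp: sym_def pres_rel_def intro: pres_eq.sym)
  show "Relation.trans (pres_rel X R)"
    by (rule transI) (auto simp: pres_rel_def intro: pres_eq.trans)
qed

lemma pres_eq_append_left: "pres_eq X R v w \<Longrightarrow> u \<in> words X \<Longrightarrow> pres_eq X R (u @ v) (u @ w)"
proof (induction rule: pres_eq.induct)
  case (cancel a b x c)
  then show ?case using pres_eq.cancel[of "u @ a" X b x R c] by simp
next
  case (relator a b r)
  then show ?case using pres_eq.relator[of "u @ a" X b r R] by simp
qed (auto intro: pres_eq.refl pres_eq.sym pres_eq.trans)

lemma pres_eq_append_right: "pres_eq X R v w \<Longrightarrow> u \<in> words X \<Longrightarrow> pres_eq X R (v @ u) (w @ u)"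
proof (induction rule: pres_eq.induct)
  case (cancel a b x c)
  then show ?case using pres_eq.cancel[of a X "b @ u" x R c] by simp
next
  case (relator a b r)
  then show ?case using pres_eq.relator[of a X "b @ u" r R] by simp
qed (auto intro: pres_eq.refl pres_eq.sym pres_eq.trans)

lemma congruent2_append:
  "congruent2 (pres_rel X R) (pres_rel X R) (\<lambda>u v. pres_rel X R `` {u @ v})"
proof (rule congruent2I')
  fix u u' v v' assume a: "(u, u') \<in> pres_rel X R" "(v, v') \<in> pres_rel X R"
  then have "pres_eq X R (u @ v) (u' @ v)" "pres_eq X R (u' @ v) (u' @ v')"
    by (auto simp: pres_rel_def dest: pres_eq_words
        intro!: pres_eq_append_left pres_eq_append_right)
  then have "(u @ v, u' @ v') \<in> pres_rel X R"
    by (auto simp: pres_rel_def intro: pres_eq.trans)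
  then show "pres_rel X R `` {u @ v} = pres_rel X R `` {u' @ v'}"
    by (rule equiv_class_eq[OF equiv_pres_rel])
qed

lemma presented_group_mult:
  assumes "u \<in> words X" "v \<in> words X"
  shows "(pres_rel X R `` {u}) \<otimes>\<^bsub>presented_group X R\<^esub> (pres_rel X R `` {v}) = pres_rel X R `` {u @ v}"
  using UN_equiv_class2[OF equiv_pres_rel equiv_pres_rel congruent2_append assms]
  by (simp add: presented_group_def)

lemma pres_inverse:
  assumes "w \<in> words X"
  shows "\<exists>w'\<in>words X. pres_eq X R (w' @ w) []"
  using assms
proof (induction w)
  case Nil
  then show ?case by (intro bexI[of _ "[]"]) (auto intro: pres_eq.refl)
next
  case (Cons a w)
  obtain x b where a: "a = (x, b)" by (cases a)
  from Cons a obtain w' where w': "w' \<in> words X" "pres_eq X R (w' @ w) []" by auto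
  have "pres_eq X R (w' @ [(x, \<not> b), (x, \<not> \<not> b)] @ w) (w' @ w)"
    using Cons.prems w' a by (intro pres_eq.cancel) auto
  then have "pres_eq X R ((w' @ [(x, \<not> b)]) @ a # w) []"
    using w' a by (auto intro: pres_eq.trans)
  then show ?case
    using w' a Cons.prems by (intro bexI[of _ "w' @ [(x, \<not> b)]"]) auto
qed

lemma group_presented_group: "group (presented_group X R)"
proof (rule groupI)
  let ?G = "presented_group X R" and ?c = "\<lambda>w. pres_rel X R `` {w}"
  have carrier: "carrier ?G = ?c ` words X"
    by (auto simp: presented_group_def quotient_def)
  have one: "\<one>\<^bsub>?G\<^esub> = ?c []"
    by (simp add: presented_group_def)
  note m = presented_group_mult
  show "\<one>\<^bsub>?G\<^esub> \<in> carrier ?G"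
    by (simp add: carrier one)
  show "x \<otimes>\<^bsub>?G\<^esub> y \<in> carrier ?G" if "x \<in> carrier ?G" "y \<in> carrier ?G" for x y
    using that by (auto simp: carrier m)
  show "x \<otimes>\<^bsub>?G\<^esub> y \<otimes>\<^bsub>?G\<^esub> z = x \<otimes>\<^bsub>?G\<^esub> (y \<otimes>\<^bsub>?G\<^esub> z)"
    if "x \<in> carrier ?G" "y \<in> carrier ?G" "z \<in> carrier ?G" for x y z
    using that by (auto simp: carrier m)
  show "\<one>\<^bsub>?G\<^esub> \<otimes>\<^bsub>?G\<^esub> x = x" if "x \<in> carrier ?G" for x
    using that by (auto simp: carrier one m)
  show "\<exists>y\<in>carrier ?G. y \<otimes>\<^bsub>?G\<^esub> x = \<one>\<^bsub>?G\<^esub>" if x: "x \<in> carrier ?G" for x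
  proof -
    from x obtain w where w: "w \<in> words X" "x = ?c w" by (auto simp: carrier)
    then obtain w' where w': "w' \<in> words X" "pres_eq X R (w' @ w) []"
      using pres_inverse by blast
    then have "?c (w' @ w) = ?c []"
      by (intro equiv_class_eq[OF equiv_pres_rel]) (simp add: pres_rel_def)
    then show ?thesis
      using w w' by (intro bexI[of _ "?c w'"]) (auto simp: carrier one m)
  qed
qed


section \<open>Edge-labelled graphs and their Coxeter groups\<close>

text \<open>
  An edge-labelled graph on a vertex set \<open>V\<close> is given by a function \<open>g\<close> on unordered pairs:
  \<open>g {i, j} = Some m\<close> means that \<open>i\<close> and \<open>j\<close> are joined by an edge labelled \<open>m\<close>, and
  \<open>g {i, j} = None\<close> that they are not adjacent.  Only the values of \<open>g\<close> on two-element subsets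
  of \<open>V\<close> matter.
\<close>

type_synonym 'v edge_labelling = "'v set \<Rightarrow> nat option"

definition vertex_pairs :: "'v set \<Rightarrow> 'v set set" where
  "vertex_pairs V = {e. e \<subseteq> V \<and> card e = 2}"

definition is_clique :: "'v set \<Rightarrow> 'v edge_labelling \<Rightarrow> 'v set \<Rightarrow> bool" where
  "is_clique V g C \<longleftrightarrow> C \<subseteq> V \<and> (\<forall>i\<in>C. \<forall>j\<in>C. i \<noteq> j \<longrightarrow> g {i, j} \<noteq> None)"

definition coxeter_relators :: "'v set \<Rightarrow> 'v edge_labelling \<Rightarrow> 'v word set" where
  "coxeter_relators V g =
    {[(i, True), (i, True)] | i. i \<in> V} \<union>
    {concat (replicate m [(i, True), (j, True)]) | i j m.
       i \<in> V \<and> j \<in> V \<and> i \<noteq> j \<and> g {i, j} = Some m}"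

definition coxeter_group :: "'v set \<Rightarrow> 'v edge_labelling \<Rightarrow> 'v word set monoid" where
  "coxeter_group V g = presented_group V (coxeter_relators V g)"

definition coxeter_gen :: "'v set \<Rightarrow> 'v edge_labelling \<Rightarrow> 'v \<Rightarrow> 'v word set" where
  "coxeter_gen V g = pres_gen V (coxeter_relators V g)"

definition FC_type :: "'v set \<Rightarrow> 'v edge_labelling \<Rightarrow> bool" where
  "FC_type V g \<longleftrightarrow>
    (\<forall>C. is_clique V g C \<longrightarrow> finite (generate (coxeter_group V g) (coxeter_gen V g ` C)))"


section \<open>Random edge-labelled graphs\<close>

definition label_prob :: "(nat \<Rightarrow> real) \<Rightarrow> nat option \<Rightarrow> real" where
  "label_prob q x = (case x of
      None \<Rightarrow> 1 - (\<Sum>\<^sub>\<infinity>m\<in>{2..}. q m)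
    | Some m \<Rightarrow> if m \<ge> 2 then q m else 0)"

definition label_pmf :: "(nat \<Rightarrow> real) \<Rightarrow> nat option pmf" where
  "label_pmf q = embed_pmf (label_prob q)"

text \<open>
  The next lemma shows that \<^const>\<open>embed_pmf\<close> is applied to a genuine probability mass function
  whenever the label probabilities are admissible.
\<close>

lemma pmf_label_pmf:
  assumes nonneg: "\<And>m. m \<ge> 2 \<Longrightarrow> q m \<ge> 0"
    and summable: "q summable_on {2..}"
    and le1: "(\<Sum>\<^sub>\<infinity>m\<in>{2..}. q m) \<le> 1"
  shows "pmf (label_pmf q) x = label_prob q x"
proof -
  let ?f = "label_prob q"
  have nn: "?f x \<ge> 0" for x
    using nonneg le1 by (auto simp: label_prob_def split: option.splits)
  have "(q has_sum (\<Sum>\<^sub>\<infinity>m\<in>{2..}. q m)) {2..}"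
    using summable by (simp add: has_sum_infsum)
  then have "(?f \<circ> Some has_sum (\<Sum>\<^sub>\<infinity>m\<in>{2..}. q m)) UNIV"
    by (rule has_sum_cong_neutral[THEN iffD1, rotated -1]) (auto simp: label_prob_def)
  then have "(?f has_sum (\<Sum>\<^sub>\<infinity>m\<in>{2..}. q m)) (range Some)"
    by (subst has_sum_reindex) auto
  then have "(?f has_sum (?f None + (\<Sum>\<^sub>\<infinity>m\<in>{2..}. q m))) (insert None (range Some))"
    by (intro has_sum_insert) auto
  then have s: "(?f has_sum 1) UNIV"
    by (simp add: label_prob_def UNIV_option_conv)
  then have "?f summable_on UNIV"
    by (rule has_sum_imp_summable)
  then have abs: "(\<lambda>x. norm (?f x)) summable_on UNIV"
    using nn by simp
  note abs' = abs_summable_equivalent[THEN iffD1, OF abs]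
  from abs' have "(\<integral>\<^sup>+x. ?f x \<partial>count_space UNIV) = ennreal (infsetsum ?f UNIV)"
    using nn by (intro nn_integral_conv_infsetsum) auto
  also have "infsetsum ?f UNIV = 1"
    using s abs' by (simp add: infsetsum_infsum infsumI)
  finally show ?thesis
    unfolding label_pmf_def using nn by (intro pmf_embed_pmf) auto
qed

definition random_graph :: "nat \<Rightarrow> (nat \<Rightarrow> real) \<Rightarrow> nat edge_labelling pmf" where
  "random_graph n q = Pi_pmf (vertex_pairs {..<n}) None (\<lambda>_. label_pmf q)"

end

theory Submission
  imports Defs "HOL-Algebra.Multiplicative_Group"
begin

text \<open>
  Call an edge big if its label is at least \<open>4\<close>.  In the diagram of a clique, where edges labelled
  \<open>2\<close> are dropped because their ends commute, the group generated by the clique is a product of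
  commuting subgroups, one for each connected component.  The hypotheses on the label probabilities
  are first moment conditions that restrict the shapes of these components.  By those on
  \<open>n\<^sup>3 p\<^sub>B\<^sup>2\<close> and \<open>n\<^sup>3 p\<^sub>B p\<^sub>3\<close>, asymptotically almost surely no big edge meets another edge of label
  at least \<open>3\<close>.  By the one on \<open>n\<^sup>5 p\<^sub>3\<^sup>4\<close>, no four edges labelled \<open>3\<close> lie on five vertices, which
  excludes trees with five vertices and four-cycles at once.  The same condition forces
  \<open>n p\<^sub>3 \<rightarrow> 0\<close>, so that triangles of such edges, of which there are on average at most \<open>(n p\<^sub>3)\<^sup>3\<close>,
  do not occur either.  A component is therefore a single big edge or a tree with at most four
  vertices, that is, a diagram of type \<open>I\<^sub>2(m)\<close>, \<open>A\<^sub>1\<close>, \<open>A\<^sub>2\<close>, \<open>A\<^sub>3\<close>, \<open>A\<^sub>4\<close> or \<open>D\<^sub>4\<close>.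

  Each of these diagrams gives a finite group.  The subgroup of \<open>W\<^sub>\<Gamma>\<close> that a clique generates
  satisfies the relations of the clique, hence it is a quotient of a product of such groups and
  finite.  Finiteness of the individual types is shown by enumerating cosets
  (\<open>finite_generate_if_cosets\<close>), and \<open>finite_component\<close> finds a component of one of these types.  That
  random labellings are sparse enough follows from union bounds (\<open>prob_not_isolated_big_edges\<close>,
  \<open>prob_not_few_three_edges\<close>).
\<close>

section \<open>Finite subgroups generated by involutions\<close>

text \<open>
  Coset enumeration: the product \<open>H T\<close> contains \<open>\<one>\<close> and is stable under right multiplication by the
  generators, so it contains everything that they generate.  Generators are involutions, which makes
  stability under their inverses automatic.
\<close>

lemma (in group) finite_generate_if_cosets:
  assumes H: "subgroup H G" "finite H"
    and T: "T \<subseteq> carrier G" "finite T" "\<one> \<in> T"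
    and S: "S \<subseteq> carrier G" "\<And>s. s \<in> S \<Longrightarrow> s \<otimes> s = \<one>"
    and step: "\<And>t s. t \<in> T \<Longrightarrow> s \<in> S \<Longrightarrow> \<exists>h\<in>H. \<exists>t'\<in>T. t \<otimes> s = h \<otimes> t'"
  shows "finite (generate G S)"
proof -
  define X where "X = (\<lambda>(h, t). h \<otimes> t) ` (H \<times> T)"
  have HG: "H \<subseteq> carrier G" using H(1) by (rule subgroup.subset)
  have XI: "h \<otimes> t \<in> X" if "h \<in> H" "t \<in> T" for h t
    using that by (auto simp: X_def)
  have XG: "X \<subseteq> carrier G" using HG T(1) by (auto simp: X_def)
  have X_closed: "x \<otimes> s \<in> X" if x: "x \<in> X" and s: "s \<in> S" for x s
  proof -
    obtain h t where ht: "h \<in> H" "t \<in> T" "x = h \<otimes> t" using x by (auto simp: X_def)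
    obtain h' t' where h't': "h' \<in> H" "t' \<in> T" "t \<otimes> s = h' \<otimes> t'"
      using step[OF ht(2) s] by blast
    have "x \<otimes> s = (h \<otimes> h') \<otimes> t'"
    proof -
      have G: "h \<in> carrier G" "t \<in> carrier G" "s \<in> carrier G" "h' \<in> carrier G" "t' \<in> carrier G"
        using ht h't' s S(1) T(1) HG by auto
      have "x \<otimes> s = h \<otimes> (t \<otimes> s)" using G ht(3) by (simp add: m_assoc)
      then show ?thesis using G h't'(3) by (simp add: m_assoc)
    qed
    then show ?thesis
      using XI subgroup.m_closed[OF H(1) ht(1) h't'(1)] h't'(2) by simp
  qed
  have XS: "x \<otimes> y \<in> X" if "y \<in> generate G S" "x \<in> X" for x y
    using that
  proof (induction arbitrary: x rule: generate.induct)
    case one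
    then show ?case using XG by auto
  next
    case (incl s)
    then show ?case using X_closed by blast
  next
    case (inv s)
    then have "inv s = s" using S by (intro inv_equality) auto
    then show ?case using inv X_closed by simp
  next
    case (eng y z)
    have "x \<otimes> (y \<otimes> z) = (x \<otimes> y) \<otimes> z"
      using eng.hyps eng.prems XG generate_in_carrier[OF S(1)] by (intro m_assoc[symmetric]) auto
    then show ?case using eng by simp
  qed
  have "\<one> \<in> X" using XI[OF subgroup.one_closed[OF H(1)] T(3)] by simp
  have "generate G S \<subseteq> X"
  proof
    fix y assume y: "y \<in> generate G S"
    then have "\<one> \<otimes> y \<in> X" using XS \<open>\<one> \<in> X\<close> by blast
    then show "y \<in> X" using generate_in_carrier[OF S(1) y] by simp
  qed
  moreover have "finite X" using H(2) T(2) by (simp add: X_def)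
  ultimately show ?thesis by (rule finite_subset)
qed

lemma (in group) generate_commutes:
  assumes "A \<subseteq> carrier G" "s \<in> carrier G" "\<And>a. a \<in> A \<Longrightarrow> a \<otimes> s = s \<otimes> a"
    and "\<And>a. a \<in> A \<Longrightarrow> a \<otimes> a = \<one>"
    and "x \<in> generate G A"
  shows "x \<otimes> s = s \<otimes> x"
  using assms(5)
proof induction
  case (inv a)
  then have "inv a = a" using assms by (intro inv_equality) auto
  then show ?case using inv assms by simp
next
  case (eng x y)
  have G: "x \<in> carrier G" "y \<in> carrier G"
    using eng.hyps generate_in_carrier[OF assms(1)] by auto
  have "x \<otimes> y \<otimes> s = (x \<otimes> s) \<otimes> y"
    using G assms(2) eng.IH(2) by (simp add: m_assoc)
  also have "\<dots> = s \<otimes> (x \<otimes> y)"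
    using G assms(2) eng.IH(1) by (simp add: m_assoc)
  finally show ?case .
qed (use assms in auto)

text \<open>
  The special case of coset enumeration in which the finite group \<open>\<langle>A\<rangle>\<close> serves as the set of coset
  representatives of \<open>\<langle>B\<rangle>\<close>.
\<close>

lemma (in group) finite_generate_commuting_union:
  assumes A: "A \<subseteq> carrier G" "\<And>a. a \<in> A \<Longrightarrow> a \<otimes> a = \<one>" "finite (generate G A)"
    and B: "B \<subseteq> carrier G" "\<And>b. b \<in> B \<Longrightarrow> b \<otimes> b = \<one>" "finite (generate G B)"
    and comm: "\<And>a b. a \<in> A \<Longrightarrow> b \<in> B \<Longrightarrow> a \<otimes> b = b \<otimes> a"
  shows "finite (generate G (A \<union> B))"
proof (rule finite_generate_if_cosets[where H = "generate G B" and T = "generate G A"])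
  fix t s assume t: "t \<in> generate G A" and s: "s \<in> A \<union> B"
  have tG: "t \<in> carrier G" using generate_in_carrier[OF A(1) t] .
  from s show "\<exists>h\<in>generate G B. \<exists>t'\<in>generate G A. t \<otimes> s = h \<otimes> t'"
  proof
    assume "s \<in> A"
    then have "t \<otimes> s \<in> generate G A" using t by (blast intro: generate.intros)
    moreover have "t \<otimes> s = \<one> \<otimes> (t \<otimes> s)" using tG \<open>s \<in> A\<close> A(1) by auto
    ultimately show ?thesis by (blast intro: generate.one)
  next
    assume "s \<in> B"
    then have "t \<otimes> s = s \<otimes> t"
      using B(1) comm by (intro generate_commutes[OF A(1) _ _ A(2) t]) blast+
    then show ?thesis using t generate.incl[OF \<open>s \<in> B\<close>] by blast
  qed
next
  show "subgroup (generate G B) G" using B(1) by (rule generate_is_subgroup)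
  show "generate G A \<subseteq> carrier G" using A(1) by (rule generate_incl)
  show "\<one> \<in> generate G A" by (rule generate.one)
qed (use A B in auto)

text \<open>
  The rotations, the powers of \<open>a b\<close>, form a finite cyclic group, and \<open>\<one>\<close> and \<open>a\<close> represent its cosets.
\<close>

lemma (in group) finite_generate_dihedral:
  assumes ab: "a \<in> carrier G" "b \<in> carrier G" "a \<otimes> a = \<one>" "b \<otimes> b = \<one>"
    and m: "(a \<otimes> b) [^] (m::nat) = \<one>" "m > 0"
  shows "finite (generate G {a, b})"
proof -
  let ?H = "generate G {a \<otimes> b}"
  have "ord (a \<otimes> b) dvd m" using m(1) ab by (simp add: pow_eq_id)
  then have "ord (a \<otimes> b) \<noteq> 0" using m(2) by auto
  then have fin: "finite ?H"
    using generate_pow_card[OF m_closed[OF ab(1,2)]] card_ge_0_finite by simp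
  show ?thesis
  proof (rule finite_generate_if_cosets[where H = ?H and T = "{\<one>, a}"])
    have inv_ab: "inv (a \<otimes> b) = b \<otimes> a"
    proof (rule inv_equality)
      have "b \<otimes> a \<otimes> (a \<otimes> b) = b \<otimes> ((a \<otimes> a) \<otimes> b)" using ab(1,2) by (simp add: m_assoc)
      then show "b \<otimes> a \<otimes> (a \<otimes> b) = \<one>" using ab by simp
    qed (use ab in auto)
    have ba: "b \<otimes> a \<in> ?H" using generate.inv[of "a \<otimes> b" "{a \<otimes> b}" G] inv_ab by simp
    have b: "b = (b \<otimes> a) \<otimes> a" using ab by (simp add: m_assoc)
    fix t s assume "t \<in> {\<one>, a}" "s \<in> {a, b}"
    then consider "t = \<one>" "s = a" | "t = \<one>" "s = b" | "t = a" "s = a" | "t = a" "s = b"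
      by blast
    then show "\<exists>h\<in>?H. \<exists>t'\<in>{\<one>, a}. t \<otimes> s = h \<otimes> t'"
    proof cases
      case 1
      then show ?thesis using ab by (intro bexI[of _ \<one>] bexI[of _ a]) (auto intro: generate.one)
    next
      case 2
      then show ?thesis using ab b ba by (intro bexI[of _ "b \<otimes> a"] bexI[of _ a]) auto
    next
      case 3
      then show ?thesis using ab by (intro bexI[of _ \<one>]) (auto intro: generate.one)
    next
      case 4
      then show ?thesis
        using ab by (intro bexI[of _ "a \<otimes> b"] bexI[of _ \<one>]) (auto intro: generate.incl)
    qed
  qed (use ab fin generate_is_subgroup[of "{a \<otimes> b}"] in auto)
qed

lemma (in group) braid_of_order_3:
  assumes ab: "a \<in> carrier G" "b \<in> carrier G" "a \<otimes> a = \<one>" "b \<otimes> b = \<one>"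
    and m: "(a \<otimes> b) [^] (3::nat) = \<one>"
  shows "a \<otimes> b \<otimes> a = b \<otimes> a \<otimes> b"
proof -
  have "(a \<otimes> b \<otimes> a) \<otimes> (b \<otimes> a \<otimes> b) = \<one>"
    using m ab by (simp add: numeral_3_eq_3 m_assoc)
  then have "inv (b \<otimes> a \<otimes> b) = a \<otimes> b \<otimes> a"
    using ab by (intro inv_equality) auto
  moreover have "(b \<otimes> a \<otimes> b) \<otimes> (b \<otimes> a \<otimes> b) = \<one>"
  proof -
    have "(b \<otimes> a \<otimes> b) \<otimes> (b \<otimes> a \<otimes> b) = b \<otimes> (a \<otimes> ((b \<otimes> b) \<otimes> (a \<otimes> b)))"
      using ab(1,2) by (simp add: m_assoc)
    also have "\<dots> = b \<otimes> ((a \<otimes> a) \<otimes> b)"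
      unfolding ab(4) using ab(1,2) by (simp add: m_assoc)
    finally show ?thesis using ab by simp
  qed
  then have "inv (b \<otimes> a \<otimes> b) = b \<otimes> a \<otimes> b"
    using ab by (intro inv_equality) auto
  ultimately show ?thesis by simp
qed

lemma (in group) commute_of_order_2:
  assumes ab: "a \<in> carrier G" "b \<in> carrier G" "a \<otimes> a = \<one>" "b \<otimes> b = \<one>"
    and m: "(a \<otimes> b) [^] (2::nat) = \<one>"
  shows "a \<otimes> b = b \<otimes> a"
proof -
  have "inv (a \<otimes> b) = a \<otimes> b"
    using m ab by (intro inv_equality) (auto simp: numeral_2_eq_2)
  moreover have "inv a = a" "inv b = b" using ab by (auto intro: inv_equality)
  ultimately show ?thesis using ab by (simp add: inv_mult_group)
qed

section \<open>Coxeter groups of types \<open>A\<close> and \<open>D\<^sub>4\<close>\<close>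

text \<open>
  The relations are those of adjacent transpositions in a symmetric group, where the subgroup on
  \<open>{1..k+1}\<close> has index \<open>k + 2\<close> in the group on \<open>{0..k+1}\<close>.  Accordingly, the induction step enumerates
  the cosets of \<open>\<langle>s 1, \<dots>, s k\<rangle>\<close> in \<open>\<langle>s 0, \<dots>, s k\<rangle>\<close>.  The representatives \<open>t i = s 0 \<dots> s (i - 1)\<close>,
  for \<open>i \<le> k + 1\<close>, correspond to the cycles on \<open>{0..i}\<close>, one for each possible position of \<open>0\<close>.
\<close>

lemma (in group) finite_generate_type_A:
  fixes s :: "nat \<Rightarrow> 'a"
  assumes "\<And>i. i < k \<Longrightarrow> s i \<in> carrier G" "\<And>i. i < k \<Longrightarrow> s i \<otimes> s i = \<one>"
    and "\<And>i. Suc i < k \<Longrightarrow> s i \<otimes> s (Suc i) \<otimes> s i = s (Suc i) \<otimes> s i \<otimes> s (Suc i)"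
    and "\<And>i j. Suc i < j \<Longrightarrow> j < k \<Longrightarrow> s i \<otimes> s j = s j \<otimes> s i"
  shows "finite (generate G (s ` {..<k}))"
  using assms
proof (induction k arbitrary: s)
  case 0
  then show ?case by (simp add: generate_empty)
next
  case (Suc k)
  note sG = Suc.prems(1) and sq = Suc.prems(2) and braid = Suc.prems(3) and comm = Suc.prems(4)
  let ?H = "generate G ((\<lambda>i. s (Suc i)) ` {..<k})"
  have fin: "finite ?H"
  proof (rule Suc.IH)
    show "s (Suc i) \<otimes> s (Suc j) = s (Suc j) \<otimes> s (Suc i)" if "Suc i < j" "j < k" for i j
      using that by (intro comm) auto
  qed (use sG sq braid in auto)
  have HI: "s (Suc i) \<in> ?H" if "i < k" for i using that by (intro generate.incl) auto
  define t where "t = rec_nat \<one> (\<lambda>i x. x \<otimes> s i)"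
  have t0: "t 0 = \<one>" and tS: "\<And>i. t (Suc i) = t i \<otimes> s i" by (simp_all add: t_def)
  have tG: "t i \<in> carrier G" if "i \<le> Suc k" for i
    using that by (induction i) (auto simp: t0 tS sG)
  \<comment> \<open>All letters of the word \<open>t i\<close> have index less than \<open>i\<close>, so none is adjacent to \<open>s j\<close>.\<close>
  have right: "t i \<otimes> s j = s j \<otimes> t i" if "i < j" "j \<le> k" for i j
    using that
  proof (induction i)
    case (Suc i)
    have "t (Suc i) \<otimes> s j = t i \<otimes> (s i \<otimes> s j)"
      using Suc.prems tG sG by (simp add: tS m_assoc)
    also have "\<dots> = (t i \<otimes> s j) \<otimes> s i"
      using Suc.prems tG sG comm[of i j] by (simp add: m_assoc)
    also have "\<dots> = s j \<otimes> t (Suc i)"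
      using Suc tG sG by (simp add: tS m_assoc)
    finally show ?case .
  qed (use sG in \<open>simp add: t0\<close>)
  \<comment> \<open>A letter of the word other than its last one passes through it, and its index grows by one:
    conjugation by the cycle \<open>t i\<close> shifts the transposition \<open>s j\<close>.\<close>
  have left: "t i \<otimes> s j = s (Suc j) \<otimes> t i" if "Suc j < i" "i \<le> Suc k" for i j
    using that
  proof (induction i)
    case (Suc i)
    show ?case
    proof (cases "i = Suc j")
      case True
      have "t (Suc i) \<otimes> s j = t j \<otimes> (s j \<otimes> s (Suc j) \<otimes> s j)"
        using Suc.prems True tG sG by (simp add: tS m_assoc)
      also have "\<dots> = (t j \<otimes> s (Suc j)) \<otimes> (s j \<otimes> s (Suc j))"
        using Suc.prems True tG sG braid[of j] by (simp add: m_assoc)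
      also have "\<dots> = s (Suc j) \<otimes> t (Suc i)"
        using Suc.prems True tG sG right[of j "Suc j"] by (simp add: tS m_assoc)
      finally show ?thesis .
    next
      case False
      have "t (Suc i) \<otimes> s j = t i \<otimes> (s i \<otimes> s j)"
        using Suc.prems tG sG by (simp add: tS m_assoc)
      also have "\<dots> = (t i \<otimes> s j) \<otimes> s i"
        using Suc.prems False tG sG comm[of j i] by (simp add: m_assoc)
      also have "\<dots> = s (Suc j) \<otimes> t (Suc i)"
        using Suc False tG sG by (simp add: tS m_assoc)
      finally show ?thesis .
    qed
  qed simp
  show ?case
  proof (rule finite_generate_if_cosets[where H = ?H and T = "t ` {..Suc k}"])
    show "subgroup ?H G" using sG by (intro generate_is_subgroup) auto
    show "\<one> \<in> t ` {..Suc k}" using t0 by (metis atMost_iff imageI le0)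
    fix x y assume "x \<in> t ` {..Suc k}" "y \<in> s ` {..<Suc k}"
    then obtain i j where i: "i \<le> Suc k" "x = t i" and j: "j \<le> k" "y = s j"
      by (auto simp: less_Suc_eq_le)
    consider "j = i" | "i = Suc j" | "i < j" | "Suc j < i" by linarith
    then show "\<exists>h\<in>?H. \<exists>t'\<in>t ` {..Suc k}. x \<otimes> y = h \<otimes> t'"
    proof cases
      case 1
      then have "x \<otimes> y = \<one> \<otimes> t (Suc i)" "Suc i \<le> Suc k"
        using i j tG[of "Suc i"] by (auto simp: tS)
      then show ?thesis by (blast intro: generate.one)
    next
      case 2
      then have "x \<otimes> y = \<one> \<otimes> t j" "j \<le> Suc k"
        using i j tG[of j] sG sq by (auto simp: tS m_assoc)
      then show ?thesis by (blast intro: generate.one)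
    next
      case 3
      then obtain l where "j = Suc l" "l < k" using j by (cases j) auto
      then show ?thesis using 3 i j right HI by blast
    next
      case 4
      then show ?thesis using i j left HI[of j] by auto
    qed
  qed (use fin sG sq tG in auto)
qed

text \<open>
  Here \<open>d\<close> is the centre of the star and \<open>a\<close>, \<open>b\<close>, \<open>c\<close> are its leaves.  The leaves \<open>a\<close> and \<open>b\<close> together
  with \<open>d\<close> form a diagram of type \<open>A\<^sub>3\<close>, whose group of order \<open>24\<close> has index \<open>8\<close> in the group of order
  \<open>192\<close> of type \<open>D\<^sub>4\<close>.  The eight representatives are the initial segments of \<open>c d a b d c\<close> and the word
  \<open>c d b\<close>.  Multiplying a representative by a generator either yields another representative or moves
  a generator \<open>a\<close>, \<open>b\<close> or \<open>d\<close> to the front.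
\<close>

lemma (in group) finite_generate_type_D4:
  assumes G: "a \<in> carrier G" "b \<in> carrier G" "c \<in> carrier G" "d \<in> carrier G"
    and sq: "a \<otimes> a = \<one>" "b \<otimes> b = \<one>" "c \<otimes> c = \<one>" "d \<otimes> d = \<one>"
    and comm: "b \<otimes> a = a \<otimes> b" "a \<otimes> c = c \<otimes> a" "b \<otimes> c = c \<otimes> b"
    and braid: "d \<otimes> a \<otimes> d = a \<otimes> d \<otimes> a" "d \<otimes> b \<otimes> d = b \<otimes> d \<otimes> b" "d \<otimes> c \<otimes> d = c \<otimes> d \<otimes> c"
  shows "finite (generate G {a, b, c, d})"
proof -
  let ?H = "generate G {a, b, d}"
  define s where "s = (\<lambda>i::nat. if i = 0 then a else if i = 1 then d else b)"
  have "finite (generate G (s ` {..<3}))"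
    using G sq comm braid
    by (intro finite_generate_type_A) (auto simp: s_def less_Suc_eq numeral_3_eq_3)
  moreover have "s ` {..<3} = {a, b, d}"
    by (auto simp: s_def image_iff lessThan_Suc numeral_3_eq_3)
  ultimately have fin: "finite ?H" by simp

  define t1 where "t1 = c"
  define t2 where "t2 = t1 \<otimes> d"
  define t3 where "t3 = t2 \<otimes> a"
  define t4 where "t4 = t2 \<otimes> b"
  define t5 where "t5 = t3 \<otimes> b"
  define t6 where "t6 = t5 \<otimes> d"
  define t7 where "t7 = t6 \<otimes> c"
  note t_def = t1_def t2_def t3_def t4_def t5_def t6_def t7_def
  have tG: "t1 \<in> carrier G" "t2 \<in> carrier G" "t3 \<in> carrier G" "t4 \<in> carrier G"
      "t5 \<in> carrier G" "t6 \<in> carrier G" "t7 \<in> carrier G"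
    using G by (simp_all add: t_def)
  \<comment> \<open>The relations as rules for the end of a word.\<close>
  have cancel: "x \<otimes> y \<otimes> y = x" if "x \<in> carrier G" "y \<in> {a, b, c, d}" for x y
    using that G sq by (auto simp: m_assoc)
  have swap: "x \<otimes> y \<otimes> z = x \<otimes> z \<otimes> y"
    if "x \<in> carrier G" "y \<in> carrier G" "z \<in> carrier G" "y \<otimes> z = z \<otimes> y" for x y z
    using that by (simp add: m_assoc)
  have braided: "x \<otimes> y \<otimes> z \<otimes> y = x \<otimes> z \<otimes> y \<otimes> z"
    if "x \<in> carrier G" "y \<in> carrier G" "z \<in> carrier G" "y \<otimes> z \<otimes> y = z \<otimes> y \<otimes> z" for x y z
    using that by (metis m_assoc m_closed)
  \<comment> \<open>The rows of the coset table: the facts \<open>e1\<close>, \<open>e2\<close>, ... describe right multiplication of \<open>t1\<close>,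
    \<open>t2\<close>, ... by the generators.\<close>
  have e1: "t1 \<otimes> a = a \<otimes> t1" "t1 \<otimes> b = b \<otimes> t1" "t1 \<otimes> c = \<one>" "t1 \<otimes> d = t2"
    using comm sq by (simp_all add: t_def)
  have e2: "t2 \<otimes> a = t3" "t2 \<otimes> b = t4" "t2 \<otimes> c = d \<otimes> t2" "t2 \<otimes> d = t1"
    using braid G sq by (simp_all add: t_def cancel m_assoc)
  have "t3 \<otimes> c = t2 \<otimes> c \<otimes> a"
    using swap[of t2 a c] tG G comm by (simp add: t3_def)
  then have e3c: "t3 \<otimes> c = d \<otimes> t3" using e2 tG G by (simp add: m_assoc)
  have "t3 \<otimes> d = t1 \<otimes> a \<otimes> d \<otimes> a"
    using braided[of t1 d a] tG G braid by (simp add: t3_def t2_def)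
  then have e3d: "t3 \<otimes> d = a \<otimes> t3" using e1 e2 tG G by (simp add: m_assoc)
  have "t4 \<otimes> c = t2 \<otimes> c \<otimes> b"
    using swap[of t2 b c] tG G comm by (simp add: t4_def)
  then have e4c: "t4 \<otimes> c = d \<otimes> t4" using e2 tG G by (simp add: m_assoc)
  have "t4 \<otimes> d = t1 \<otimes> b \<otimes> d \<otimes> b"
    using braided[of t1 d b] tG G braid by (simp add: t4_def t2_def)
  then have e4d: "t4 \<otimes> d = b \<otimes> t4" using e1 e2 tG G by (simp add: m_assoc)
  have e3: "t3 \<otimes> a = t2" "t3 \<otimes> b = t5" by (simp_all add: t3_def t5_def cancel tG)
  have e4: "t4 \<otimes> a = t5" "t4 \<otimes> b = t2"
    using swap[of t2 b a] tG G comm by (simp_all add: t4_def t5_def t3_def cancel)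
  have e5: "t5 \<otimes> a = t4" "t5 \<otimes> b = t3" "t5 \<otimes> d = t6"
    using cancel[of t4 a] cancel[of t3 b] e4(1) tG by (simp_all add: t5_def t6_def)
  have "t5 \<otimes> c = t3 \<otimes> c \<otimes> b"
    using swap[of t3 b c] tG G comm by (simp add: t5_def)
  then have e5c: "t5 \<otimes> c = d \<otimes> t5" using e3c e3 tG G by (simp add: m_assoc)
  have e6: "t6 \<otimes> c = t7" "t6 \<otimes> d = t5" by (simp_all add: t6_def t7_def cancel tG)
  have "t6 \<otimes> a = t4 \<otimes> a \<otimes> d \<otimes> a"
    by (simp add: t6_def e4)
  then have "t6 \<otimes> a = t4 \<otimes> d \<otimes> a \<otimes> d"
    using braided[of t4 a d] tG G braid by simp
  then have e6a: "t6 \<otimes> a = b \<otimes> t6" using e4d e4 e5 tG G by (simp add: m_assoc)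
  have "t6 \<otimes> b = t3 \<otimes> b \<otimes> d \<otimes> b"
    by (simp add: t6_def e3)
  then have "t6 \<otimes> b = t3 \<otimes> d \<otimes> b \<otimes> d"
    using braided[of t3 b d] tG G braid by simp
  then have e6b: "t6 \<otimes> b = a \<otimes> t6" using e3d e3 e5 tG G by (simp add: m_assoc)
  have "t7 \<otimes> a = t6 \<otimes> a \<otimes> c" "t7 \<otimes> b = t6 \<otimes> b \<otimes> c"
    using swap[of t6 a c] swap[of t6 b c] tG G comm by (simp_all add: t7_def)
  then have e7: "t7 \<otimes> a = b \<otimes> t7" "t7 \<otimes> b = a \<otimes> t7"
    using e6a e6b e6 tG G by (simp_all add: m_assoc)
  have e7c: "t7 \<otimes> c = t6" by (simp add: t7_def cancel tG)
  have "t7 \<otimes> d = t5 \<otimes> c \<otimes> d \<otimes> c"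
    using braided[of t5 d c] tG G braid by (simp add: t7_def t6_def)
  then have e7d: "t7 \<otimes> d = d \<otimes> t7" using e5c e5 e6 tG G by (simp add: m_assoc)
  let ?T = "{\<one>, t1, t2, t3, t4, t5, t6, t7}"
  define P where "P x \<longleftrightarrow> (\<exists>h\<in>?H. \<exists>t\<in>?T. x = h \<otimes> t)" for x
  have TG: "?T \<subseteq> carrier G" using tG by simp
  have PI: "P (h \<otimes> t)" if "h \<in> {a, b, d}" "t \<in> ?T" for h t
    unfolding P_def using that generate.incl[OF that(1)] by blast
  have P1: "P t" if "t \<in> ?T" for t
  proof -
    have "t = \<one> \<otimes> t" using l_one[OF subsetD[OF TG that]] by simp
    then show ?thesis unfolding P_def using that generate.one by blast
  qed
  have PT: "P \<one>" "P t1" "P t2" "P t3" "P t4" "P t5" "P t6" "P t7"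
    by (simp_all add: P1)
  have "P a" "P b" "P d"
    using PI[of a \<one>] PI[of b \<one>] PI[of d \<one>] G by simp_all
  moreover have "P c" using PT(2) by (simp only: t1_def)
  ultimately have PS: "P a" "P b" "P c" "P d" by blast+
  have PH: "P (a \<otimes> t)" "P (b \<otimes> t)" "P (d \<otimes> t)" if "t \<in> ?T" for t
    using PI[of _ t] that by simp_all
  have closed: "P (t \<otimes> s)" if t: "t \<in> ?T" and s: "s \<in> {a, b, c, d}" for t s
  proof -
    have "\<forall>t\<in>?T. \<forall>s\<in>{a, b, c, d}. P (t \<otimes> s)"
      by (simp add: e1 e2 e3 e3c e3d e4 e4c e4d e5 e5c e6 e6a e6b e7 e7c e7d G PS PT PH)
    then show ?thesis using t s by blast
  qed
  show ?thesis
  proof (rule finite_generate_if_cosets[where H = ?H and T = ?T])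
    show "\<exists>h\<in>?H. \<exists>t'\<in>?T. t \<otimes> s = h \<otimes> t'" if "t \<in> ?T" "s \<in> {a, b, c, d}" for t s
      using closed[OF that] unfolding P_def .
    show "subgroup ?H G" using G by (intro generate_is_subgroup) auto
  qed (use fin G sq TG in auto)
qed

section \<open>Sparse labellings\<close>

definition three_edges :: "'v edge_labelling \<Rightarrow> 'v set \<Rightarrow> 'v set set" where
  "three_edges g U = {e \<in> vertex_pairs U. g e = Some 3}"

definition isolated_big_edges :: "'v set \<Rightarrow> 'v edge_labelling \<Rightarrow> bool" where
  "isolated_big_edges V g \<longleftrightarrow> (\<forall>x\<in>V. \<forall>y\<in>V. \<forall>z\<in>V. \<forall>k l. distinct [x, y, z] \<longrightarrow>
     g {x, y} = Some k \<longrightarrow> k \<ge> 4 \<longrightarrow> g {x, z} = Some l \<longrightarrow> l < 3)"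

definition few_three_edges :: "nat \<Rightarrow> nat \<Rightarrow> 'v set \<Rightarrow> 'v edge_labelling \<Rightarrow> bool" where
  "few_three_edges k j V g \<longleftrightarrow> (\<forall>U\<subseteq>V. card U \<le> k \<longrightarrow> card (three_edges g U) < j)"

text \<open>
  Three edges on three vertices form a triangle; four edges on at most five vertices occur in every
  connected graph with five vertices and in the four-cycle.  Counting edges covers all these shapes
  without listing them.
\<close>

definition sparse :: "'v set \<Rightarrow> 'v edge_labelling \<Rightarrow> bool" where
  "sparse V g \<longleftrightarrow> isolated_big_edges V g \<and> few_three_edges 3 3 V g \<and> few_three_edges 5 4 V g"

lemma sparse_mono: "sparse V g \<Longrightarrow> C \<subseteq> V \<Longrightarrow> sparse C g"
  unfolding sparse_def isolated_big_edges_def few_three_edges_def by (meson subset_iff)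

lemma few_three_edgesD:
  assumes "few_three_edges k j V g" "U \<subseteq> V" "finite U" "card U \<le> k"
    and "distinct es" "set es \<subseteq> three_edges g U"
  shows "length es < j"
proof -
  have "finite (three_edges g U)"
    using assms(3) by (simp add: three_edges_def vertex_pairs_def)
  then have "length es \<le> card (three_edges g U)"
    using assms(5,6) card_mono distinct_card by metis
  also have "\<dots> < j" using assms(1,2,4) by (auto simp: few_three_edges_def)
  finally show ?thesis .
qed

section \<open>Groups generated by a clique\<close>

text \<open>
  The elements \<open>s i\<close> are required to satisfy the Coxeter relations, but the group may be larger than
  the one they generate, and they may satisfy more relations.  So the locale applies to the
  generators of a clique inside the Coxeter group of the whole graph.
\<close>

locale coxeter_clique = group +
  fixes C :: "'v set" and g :: "'v edge_labelling" and s :: "'v \<Rightarrow> 'a"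
  assumes fin: "finite C"
    and gen_closed: "i \<in> C \<Longrightarrow> s i \<in> carrier G"
    and gen_square: "i \<in> C \<Longrightarrow> s i \<otimes> s i = \<one>"
    and gen_power: "i \<in> C \<Longrightarrow> j \<in> C \<Longrightarrow> i \<noteq> j \<Longrightarrow> g {i, j} = Some m \<Longrightarrow> (s i \<otimes> s j) [^] m = \<one>"
    and label: "i \<in> C \<Longrightarrow> j \<in> C \<Longrightarrow> i \<noteq> j \<Longrightarrow> \<exists>m\<ge>2. g {i, j} = Some m"
    and sparse_clique: "sparse C g"
begin

definition adj :: "'v \<Rightarrow> 'v \<Rightarrow> bool" where
  "adj i j \<longleftrightarrow> i \<in> C \<and> j \<in> C \<and> i \<noteq> j \<and> g {i, j} = Some 3"

lemma adj_sym: "adj i j \<Longrightarrow> adj j i"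
  by (auto simp: adj_def insert_commute)

lemma gens_commute: "i \<in> C \<Longrightarrow> j \<in> C \<Longrightarrow> i \<noteq> j \<Longrightarrow> g {i, j} = Some 2 \<Longrightarrow> s i \<otimes> s j = s j \<otimes> s i"
  using gen_closed gen_square gen_power by (intro commute_of_order_2) auto

lemma gens_braid: "adj i j \<Longrightarrow> s i \<otimes> s j \<otimes> s i = s j \<otimes> s i \<otimes> s j"
  unfolding adj_def using gen_closed gen_square gen_power by (intro braid_of_order_3) auto

lemma no_triangle:
  assumes "adj x y" "adj y z" "adj x z"
  shows False
proof -
  have "few_three_edges 3 3 C g" using sparse_clique by (simp add: sparse_def)
  then have "length [{x, y}, {y, z}, {x, z}] < 3"
    by (rule few_three_edgesD[where U = "{x, y, z}"])
      (use assms in \<open>auto simp: adj_def three_edges_def vertex_pairs_def doubleton_eq_iff card_insert_if\<close>)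
  then show False by simp
qed

text \<open>
  The list \<open>us\<close> may repeat vertices or have fewer than five entries, which lets the same rule exclude
  four-cycles.
\<close>

lemma no_four_edges:
  assumes "adj a1 b1" "adj a2 b2" "adj a3 b3" "adj a4 b4"
    and "distinct [{a1, b1}, {a2, b2}, {a3, b3}, {a4, b4}]"
    and "set [a1, b1, a2, b2, a3, b3, a4, b4] \<subseteq> set us" "length us \<le> 5"
  shows False
proof -
  let ?U = "{a1, b1, a2, b2, a3, b3, a4, b4}"
  have "few_three_edges 5 4 C g" using sparse_clique by (simp add: sparse_def)
  moreover have "?U \<subseteq> C" using assms(1-4) by (auto simp: adj_def)
  moreover have "card ?U \<le> 5"
    using card_mono[OF _ assms(6)] card_length[of us] assms(7) by simp
  moreover have "set [{a1, b1}, {a2, b2}, {a3, b3}, {a4, b4}] \<subseteq> three_edges g ?U"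
    using assms(1-4) by (auto simp: adj_def three_edges_def vertex_pairs_def)
  ultimately have "length [{a1, b1}, {a2, b2}, {a3, b3}, {a4, b4}] < 4"
    using assms(5) by (intro few_three_edgesD) auto
  then show False by simp
qed

lemma finite_generate_path:
  assumes "set vs \<subseteq> C" "distinct vs"
    and "\<And>i. Suc i < length vs \<Longrightarrow> adj (vs ! i) (vs ! Suc i)"
    and "\<And>i j. Suc i < j \<Longrightarrow> j < length vs \<Longrightarrow> g {vs ! i, vs ! j} = Some 2"
  shows "finite (generate G (s ` set vs))"
proof -
  have C: "vs ! i \<in> C" if "i < length vs" for i using that assms(1) by (auto simp: subset_iff)
  have "finite (generate G ((\<lambda>i. s (vs ! i)) ` {..<length vs}))"
  proof (rule finite_generate_type_A)
    fix i j assume "Suc i < j" "j < length vs"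
    then show "s (vs ! i) \<otimes> s (vs ! j) = s (vs ! j) \<otimes> s (vs ! i)"
      using assms C by (intro gens_commute) (auto simp: nth_eq_iff_index_eq)
  next
    fix i assume "Suc i < length vs"
    then show "s (vs ! i) \<otimes> s (vs ! Suc i) \<otimes> s (vs ! i) = s (vs ! Suc i) \<otimes> s (vs ! i) \<otimes> s (vs ! Suc i)"
      by (intro gens_braid assms(3))
  qed (use C gen_closed gen_square in auto)
  moreover have "(\<lambda>i. s (vs ! i)) ` {..<length vs} = s ` set vs"
    by (auto simp: set_conv_nth)
  ultimately show ?thesis by simp
qed

text \<open>
  A big edge is a component by itself.  If there is none, take the first that occurs among the
  shapes star with three leaves, path with four, with three, with two vertices, and single vertex.
  It is a whole component: an edge leaving it would produce either an earlier shape or four edges on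
  five vertices.  Triangles and four-cycles being absent, it has no chords, so it is a diagram of
  type \<open>D\<^sub>4\<close>, \<open>A\<^sub>4\<close>, \<open>A\<^sub>3\<close>, \<open>A\<^sub>2\<close> or \<open>A\<^sub>1\<close>.
\<close>

lemma finite_component:
  assumes "C \<noteq> {}"
  obtains K where "K \<subseteq> C" "K \<noteq> {}" "finite (generate G (s ` K))"
    "\<And>i j. i \<in> K \<Longrightarrow> j \<in> C - K \<Longrightarrow> g {i, j} = Some 2"
proof (cases "\<exists>i\<in>C. \<exists>j\<in>C. i \<noteq> j \<and> (\<exists>m\<ge>4. g {i, j} = Some m)")
  case True
  then obtain i j m where ij: "i \<in> C" "j \<in> C" "i \<noteq> j" "m \<ge> 4" "g {i, j} = Some m" by blast
  have *: "g {x, z} = Some 2"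
    if xyz: "x \<in> C" "y \<in> C" "z \<in> C" "distinct [x, y, z]" "g {x, y} = Some m" for x y z
  proof -
    have "x \<noteq> z" using xyz(4) by simp
    then obtain l where l: "l \<ge> 2" "g {x, z} = Some l" using label xyz(1,3) by blast
    have "l < 3" using sparse_clique xyz l(2) ij(4) unfolding sparse_def isolated_big_edges_def by blast
    then show ?thesis using l by simp
  qed
  have "finite (generate G {s i, s j})"
    using ij gen_closed gen_square gen_power[of i j m]
    by (intro finite_generate_dihedral[where m = m]) auto
  then show ?thesis
    using ij *[of i j] *[of j i] by (intro that[of "{i, j}"]) (auto simp: insert_commute)
next
  case False
  have nonadj: "g {i, j} = Some 2" if ij: "i \<in> C" "j \<in> C" "i \<noteq> j" "\<not> adj i j" for i j
  proof -
    obtain m where m: "m \<ge> 2" "g {i, j} = Some m" using label[of i j] ij by auto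
    then have "m \<noteq> 3" "\<not> m \<ge> 4" using ij False by (auto simp: adj_def)
    then show ?thesis using m by auto
  qed
  consider (star) v a b c where "distinct [a, b, c]" "adj v a" "adj v b" "adj v c"
    | (path4) a b c d where "distinct [a, b, c, d]" "adj a b" "adj b c" "adj c d"
    | (path3) a b c where "a \<noteq> c" "adj a b" "adj b c"
        "\<nexists>v a b c. distinct [a, b, c] \<and> adj v a \<and> adj v b \<and> adj v c"
        "\<nexists>a b c d. distinct [a, b, c, d] \<and> adj a b \<and> adj b c \<and> adj c d"
    | (edge) a b where "adj a b" "\<nexists>a b c. a \<noteq> c \<and> adj a b \<and> adj b c"
    | (isolated) "\<nexists>a b. adj a b"
    by metis
  then show ?thesis
  proof cases
    case star
    have V: "v \<in> C" "a \<in> C" "b \<in> C" "c \<in> C" "v \<noteq> a" "v \<noteq> b" "v \<noteq> c"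
      using star by (auto simp: adj_def)
    have leaves: "\<not> adj a b" "\<not> adj a c" "\<not> adj b c"
      using no_triangle star by blast+
    have "finite (generate G {s a, s b, s c, s v})"
    proof (rule finite_generate_type_D4)
      show "s b \<otimes> s a = s a \<otimes> s b" "s a \<otimes> s c = s c \<otimes> s a" "s b \<otimes> s c = s c \<otimes> s b"
        using star(1) V leaves nonadj adj_sym by (auto intro!: gens_commute)
    qed (use V gen_closed gen_square gens_braid star in auto)
    moreover have "s ` {a, b, c, v} = {s a, s b, s c, s v}" by simp
    moreover have "g {i, j} = Some 2" if "i \<in> {a, b, c, v}" "j \<in> C - {a, b, c, v}" for i j
    proof (rule nonadj)
      show "\<not> adj i j"
      proof
        assume "adj i j"
        then show False
          using star that
          by (intro no_four_edges[of v a v b v c i j "[a, b, c, v, j]"])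
            (auto simp: doubleton_eq_iff)
      qed
    qed (use that V in auto)
    ultimately show ?thesis using V by (intro that[of "{a, b, c, v}"]) auto
  next
    case path4
    have V: "a \<in> C" "b \<in> C" "c \<in> C" "d \<in> C"
      using path4 by (auto simp: adj_def)
    have chords: "\<not> adj a c" "\<not> adj b d"
      using no_triangle path4 by blast+
    have "\<not> adj a d"
    proof
      assume "adj a d"
      then show False
        using path4
        by (intro no_four_edges[of a b b c c d a d "[a, b, c, d]"]) (auto simp: doubleton_eq_iff)
    qed
    then have "finite (generate G (s ` set [a, b, c, d]))"
      using path4 V chords
      by (intro finite_generate_path) (auto simp: less_Suc_eq nth_Cons' intro!: nonadj)
    moreover have "g {i, j} = Some 2" if "i \<in> {a, b, c, d}" "j \<in> C - {a, b, c, d}" for i j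
    proof (rule nonadj)
      show "\<not> adj i j"
      proof
        assume "adj i j"
        then show False
          using path4 that
          by (intro no_four_edges[of a b b c c d i j "[a, b, c, d, j]"])
            (auto simp: doubleton_eq_iff)
      qed
    qed (use that V in auto)
    ultimately show ?thesis using V by (intro that[of "{a, b, c, d}"]) auto
  next
    case path3
    have V: "a \<in> C" "b \<in> C" "c \<in> C" "a \<noteq> b" "b \<noteq> c"
      using path3 by (auto simp: adj_def)
    have "\<not> adj a c" using no_triangle path3 by blast
    then have "finite (generate G (s ` set [a, b, c]))"
      using path3(1-3) V
      by (intro finite_generate_path) (auto simp: less_Suc_eq nth_Cons' intro!: nonadj)
    moreover have "g {i, j} = Some 2" if i: "i \<in> {a, b, c}" and j: "j \<in> C - {a, b, c}" for i j
    proof (rule nonadj)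
      have "distinct [j, a, b, c]" "distinct [a, c, j]" "distinct [a, b, c, j]"
        using path3(1) V j by auto
      then show "\<not> adj i j" using i path3(2-5) adj_sym by blast
    qed (use i j V in auto)
    ultimately show ?thesis using V by (intro that[of "{a, b, c}"]) auto
  next
    case edge
    have V: "a \<in> C" "b \<in> C" "a \<noteq> b" using edge by (auto simp: adj_def)
    have "finite (generate G (s ` set [a, b]))"
      using edge(1) V by (intro finite_generate_path) (auto simp: less_Suc_eq)
    moreover have "g {i, j} = Some 2" if i: "i \<in> {a, b}" and j: "j \<in> C - {a, b}" for i j
    proof (rule nonadj)
      show "\<not> adj i j" using i j edge adj_sym by blast
    qed (use i j V in auto)
    ultimately show ?thesis using V by (intro that[of "{a, b}"]) auto
  next
    case isolated
    obtain v where v: "v \<in> C" using assms by blast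
    have "finite (generate G (s ` set [v]))"
      using v by (intro finite_generate_path) auto
    then show ?thesis
      using v isolated by (intro that[of "{v}"]) (auto intro!: nonadj)
  qed
qed

end

text \<open>
  A component commutes with the rest of the clique, which is again a sparse clique; so components can
  be split off one at a time.
\<close>

lemma (in group) finite_generate_sparse_clique:
  assumes "coxeter_clique G C g s"
  shows "finite (generate G (s ` C))"
proof -
  have "finite C" using assms by (rule coxeter_clique.fin)
  then show ?thesis
    using assms
  proof (induction C rule: finite_psubset_induct)
    case (psubset C)
    interpret coxeter_clique G C g s by (rule psubset.prems)
    show ?case
    proof (cases "C = {}")
      case True
      then show ?thesis by (simp add: generate_empty)
    next
      case False
      then obtain K where K: "K \<subseteq> C" "K \<noteq> {}" "finite (generate G (s ` K))"
        "\<And>i j. i \<in> K \<Longrightarrow> j \<in> C - K \<Longrightarrow> g {i, j} = Some 2"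
        using finite_component by blast
      have "coxeter_clique G (C - K) g s"
        using fin gen_closed gen_square gen_power label sparse_mono[OF sparse_clique]
        by unfold_locales auto
      then have "finite (generate G (s ` (C - K)))"
        using psubset.IH[of "C - K"] K(1,2) by blast
      moreover have "s i \<otimes> s j = s j \<otimes> s i" if "i \<in> K" "j \<in> C - K" for i j
        using that K(1,4) by (intro gens_commute) auto
      ultimately have "finite (generate G (s ` K \<union> s ` (C - K)))"
        using K(1,3) gen_closed gen_square
        by (intro finite_generate_commuting_union) auto
      moreover have "s ` K \<union> s ` (C - K) = s ` C" using K(1) by blast
      ultimately show ?thesis by simp
    qed
  qed
qed

section \<open>Sparse labellings are of FC-type\<close>

lemma coxeter_gen_closed:
  assumes "i \<in> V"
  shows "coxeter_gen V g i \<in> carrier (coxeter_group V g)"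
  using assms unfolding coxeter_gen_def pres_gen_def coxeter_group_def
  by (auto simp: presented_group_def intro!: quotientI)

lemma relator_class:
  assumes "r \<in> R" "r \<in> words X"
  shows "pres_rel X R `` {r} = \<one>\<^bsub>presented_group X R\<^esub>"
proof -
  have "pres_eq X R r []"
    using pres_eq.relator[of "[]" X "[]" r R] assms by simp
  then show ?thesis
    using equiv_class_eq[OF equiv_pres_rel, of r "[]" X R]
    by (simp add: presented_group_def pres_rel_def)
qed

lemma coxeter_gen_square:
  assumes "i \<in> V"
  shows "coxeter_gen V g i \<otimes>\<^bsub>coxeter_group V g\<^esub> coxeter_gen V g i = \<one>\<^bsub>coxeter_group V g\<^esub>"
  using assms unfolding coxeter_gen_def pres_gen_def coxeter_group_def
  by (subst presented_group_mult) (auto simp: coxeter_relators_def intro!: relator_class)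

lemma coxeter_gen_power:
  assumes "i \<in> V" "j \<in> V" "i \<noteq> j" "g {i, j} = Some m"
  shows "(coxeter_gen V g i \<otimes>\<^bsub>coxeter_group V g\<^esub> coxeter_gen V g j) [^]\<^bsub>coxeter_group V g\<^esub> m
    = \<one>\<^bsub>coxeter_group V g\<^esub>"
proof -
  let ?R = "coxeter_relators V g" and ?G = "coxeter_group V g"
  let ?c = "\<lambda>w. pres_rel V ?R `` {w}" and ?w = "\<lambda>m. concat (replicate m [(i, True), (j, True)])"
  interpret group ?G unfolding coxeter_group_def by (rule group_presented_group)
  have words: "?w m \<in> words V" for m using assms by (induction m) auto
  have "(coxeter_gen V g i \<otimes>\<^bsub>?G\<^esub> coxeter_gen V g j) [^]\<^bsub>?G\<^esub> m = ?c (?w m)" for m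
  proof (induction m)
    case 0
    then show ?case by (simp add: coxeter_group_def presented_group_def)
  next
    case (Suc m)
    have "replicate (Suc m) x = replicate m x @ [x]" for x :: "'a word"
      by (simp add: replicate_append_same)
    then have "?w (Suc m) = ?w m @ [(i, True), (j, True)]"
      by (simp del: replicate_Suc)
    moreover have "coxeter_gen V g i \<otimes>\<^bsub>?G\<^esub> coxeter_gen V g j = ?c [(i, True), (j, True)]"
      using assms unfolding coxeter_gen_def pres_gen_def coxeter_group_def
      by (subst presented_group_mult) auto
    ultimately show ?case
      using Suc presented_group_mult[of "?w m" V "[(i, True), (j, True)]" ?R] words assms
      by (simp add: coxeter_group_def)
  qed
  also have "?c (?w m) = \<one>\<^bsub>?G\<^esub>"
    unfolding coxeter_group_def
  proof (rule relator_class[OF _ words])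
    show "?w m \<in> ?R" using assms unfolding coxeter_relators_def by blast
  qed
  finally show ?thesis .
qed

lemma FC_type_if_sparse:
  assumes "finite V" "sparse V g"
    and "\<And>e m. e \<in> vertex_pairs V \<Longrightarrow> g e = Some m \<Longrightarrow> m \<ge> 2"
  shows "FC_type V g"
  unfolding FC_type_def
proof (intro allI impI)
  fix C assume C: "is_clique V g C"
  interpret group "coxeter_group V g"
    unfolding coxeter_group_def by (rule group_presented_group)
  have "coxeter_clique (coxeter_group V g) C g (coxeter_gen V g)"
  proof unfold_locales
    fix i j assume ij: "i \<in> C" "j \<in> C" "i \<noteq> j"
    then have "g {i, j} \<noteq> None" "{i, j} \<in> vertex_pairs V"
      using C by (auto simp: is_clique_def vertex_pairs_def)
    then show "\<exists>m\<ge>2. g {i, j} = Some m" using assms(3) by blast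
  next
    show "finite C" using C assms(1) by (auto simp: is_clique_def intro: finite_subset)
    show "sparse C g" using C assms(2) by (auto simp: is_clique_def intro: sparse_mono)
  next
    fix i assume "i \<in> C"
    then have i: "i \<in> V" using C by (auto simp: is_clique_def)
    show "coxeter_gen V g i \<in> carrier (coxeter_group V g)"
      using i by (rule coxeter_gen_closed)
    show "coxeter_gen V g i \<otimes>\<^bsub>coxeter_group V g\<^esub> coxeter_gen V g i = \<one>\<^bsub>coxeter_group V g\<^esub>"
      using i by (rule coxeter_gen_square)
  next
    fix i j m assume "i \<in> C" "j \<in> C" "i \<noteq> j" "g {i, j} = Some m"
    then show "(coxeter_gen V g i \<otimes>\<^bsub>coxeter_group V g\<^esub> coxeter_gen V g j)
        [^]\<^bsub>coxeter_group V g\<^esub> m = \<one>\<^bsub>coxeter_group V g\<^esub>"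
      using C by (intro coxeter_gen_power) (auto simp: is_clique_def)
  qed
  then show "finite (generate (coxeter_group V g) (coxeter_gen V g ` C))"
    by (rule finite_generate_sparse_clique)
qed

section \<open>Random labellings\<close>

definition label_weights :: "(nat \<Rightarrow> real) \<Rightarrow> bool" where
  "label_weights q \<longleftrightarrow> (\<forall>m\<ge>2. q m \<ge> 0) \<and> q summable_on {2..} \<and> (\<Sum>\<^sub>\<infinity>m\<in>{2..}. q m) \<le> 1"

lemma pmf_label: "label_weights q \<Longrightarrow> pmf (label_pmf q) x = label_prob q x"
  unfolding label_weights_def by (intro pmf_label_pmf) auto

lemma prob_label_in:
  assumes "label_weights q" "A \<subseteq> {2..}"
  shows "measure_pmf.prob (label_pmf q) (Some ` A) = (\<Sum>\<^sub>\<infinity>m\<in>A. q m)"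
proof -
  have "measure_pmf.prob (label_pmf q) (Some ` A) = (\<Sum>\<^sub>\<infinity>x\<in>Some ` A. pmf (label_pmf q) x)"
    by (subst measure_pmf_conv_infsetsum) (rule infsetsum_infsum[OF pmf_abs_summable])
  also have "\<dots> = (\<Sum>\<^sub>\<infinity>m\<in>A. q m)"
    using assms by (subst infsum_reindex)
      (auto simp: pmf_label label_prob_def subset_iff intro!: infsum_cong)
  finally show ?thesis .
qed

lemma prob_label_ge_3:
  assumes "label_weights q"
  shows "measure_pmf.prob (label_pmf q) (Some ` {3..}) = (\<Sum>\<^sub>\<infinity>m\<in>{4..}. q m) + q 3"
proof -
  have "Some ` {3::nat..} = Some ` {4..} \<union> Some ` {3}" by (force simp: image_iff)
  then have "measure_pmf.prob (label_pmf q) (Some ` {3..}) =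
      measure_pmf.prob (label_pmf q) (Some ` {4..}) + measure_pmf.prob (label_pmf q) (Some ` {3})"
    by (subst measure_pmf.finite_measure_Union[symmetric]) auto
  then show ?thesis
    using prob_label_in[OF assms, of "{4..}"] prob_label_in[OF assms, of "{3}"] by simp
qed

lemma finite_vertex_pairs: "finite V \<Longrightarrow> finite (vertex_pairs V)"
  by (simp add: vertex_pairs_def)

lemma random_graph_labels_ge_2:
  assumes "label_weights q" "g \<in> set_pmf (random_graph n q)"
    and "e \<in> vertex_pairs {..<n}" "g e = Some m"
  shows "m \<ge> 2"
proof -
  have "g e \<in> set_pmf (label_pmf q)"
    using assms(2,3) unfolding random_graph_def
    by (auto simp: set_Pi_pmf finite_vertex_pairs PiE_dflt_def)
  then have "label_prob q (Some m) \<noteq> 0"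
    using assms(1,4) by (simp add: set_pmf_iff pmf_label)
  then show ?thesis by (simp add: label_prob_def split: if_splits)
qed

lemma prob_random_graph_labels:
  assumes "F \<subseteq> vertex_pairs {..<n}"
  shows "measure_pmf.prob (random_graph n q) {g. \<forall>e\<in>F. g e \<in> L e} =
    (\<Prod>e\<in>F. measure_pmf.prob (label_pmf q) (L e))"
proof -
  let ?A = "vertex_pairs {..<n}" and ?L = "\<lambda>e. if e \<in> F then L e else UNIV"
  have fin: "finite ?A" by (simp add: finite_vertex_pairs)
  have "{g. \<forall>e\<in>F. g e \<in> L e} = Pi ?A ?L"
    using assms by (auto simp: Pi_def)
  then have "measure_pmf.prob (random_graph n q) {g. \<forall>e\<in>F. g e \<in> L e} =
      (\<Prod>e\<in>?A. measure_pmf.prob (label_pmf q) (?L e))"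
    unfolding random_graph_def using measure_Pi_pmf_Pi[OF fin] by simp
  also have "\<dots> = (\<Prod>e\<in>F. measure_pmf.prob (label_pmf q) (?L e))"
    using fin assms by (intro prod.mono_neutral_right) auto
  also have "\<dots> = (\<Prod>e\<in>F. measure_pmf.prob (label_pmf q) (L e))"
    by (intro prod.cong) auto
  finally show ?thesis .
qed

lemma prob_union_bound:
  fixes M :: "'b pmf" and c :: real
  assumes "finite I" "A \<subseteq> (\<Union>i\<in>I. B i)" "\<And>i. i \<in> I \<Longrightarrow> measure_pmf.prob M (B i) \<le> c"
  shows "measure_pmf.prob M A \<le> card I * c"
proof -
  have "measure_pmf.prob M A \<le> measure_pmf.prob M (\<Union>i\<in>I. B i)"
    using assms(2) by (intro measure_pmf.finite_measure_mono) auto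
  also have "\<dots> \<le> (\<Sum>i\<in>I. measure_pmf.prob M (B i))"
    using assms(1) by (intro measure_pmf.finite_measure_subadditive_finite) auto
  also have "\<dots> \<le> card I * c"
    using sum_mono[of I "\<lambda>i. measure_pmf.prob M (B i)" "\<lambda>_. c"] assms(3) by simp
  finally show ?thesis .
qed

text \<open>
  There are at most \<open>n\<^sup>3\<close> triples of vertices \<open>x\<close>, \<open>y\<close>, \<open>z\<close>, and for each of them the labels of
  \<open>{x, y}\<close> and \<open>{x, z}\<close> are independent.
\<close>

lemma prob_not_isolated_big_edges:
  assumes q: "label_weights q" and P: "P = (\<Sum>\<^sub>\<infinity>m\<in>{4..}. q m)"
  shows "measure_pmf.prob (random_graph n q) {g. \<not> isolated_big_edges {..<n} g}
    \<le> real n ^ 3 * (P * (P + q 3))"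
proof -
  define I where "I = {xs. set xs \<subseteq> {..<n} \<and> length xs = 3}"
  define B :: "nat list \<Rightarrow> nat edge_labelling set" where
    "B xs = {g. distinct xs \<and> g {xs!0, xs!1} \<in> Some ` {4..} \<and> g {xs!0, xs!2} \<in> Some ` {3..}}" for xs
  have P0: "P * (P + q 3) \<ge> 0"
    using q unfolding P label_weights_def
    by (intro mult_nonneg_nonneg add_nonneg_nonneg infsum_nonneg) auto
  have cover: "{g. \<not> isolated_big_edges {..<n} g} \<subseteq> (\<Union>xs\<in>I. B xs)"
  proof
    fix g :: "nat edge_labelling" assume "g \<in> {g. \<not> isolated_big_edges {..<n} g}"
    then obtain x y z k l where "x < n" "y < n" "z < n" "distinct [x, y, z]"
      "g {x, y} = Some k" "k \<ge> 4" "g {x, z} = Some l" "l \<ge> 3"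
      unfolding isolated_big_edges_def by (auto simp: not_less)
    then have "[x, y, z] \<in> I" "g \<in> B [x, y, z]" by (auto simp: I_def B_def)
    then show "g \<in> (\<Union>xs\<in>I. B xs)" by blast
  qed
  have each: "measure_pmf.prob (random_graph n q) (B xs) \<le> P * (P + q 3)" if xs: "xs \<in> I" for xs
  proof (cases "distinct xs")
    case False
    then have "B xs = {}" by (auto simp: B_def)
    then show ?thesis using P0 by simp
  next
    case True
    from xs obtain x y z where "xs = [x, y, z]"
      by (auto simp: I_def numeral_3_eq_3 length_Suc_conv)
    then have xyz: "xs = [x, y, z]" "x < n" "y < n" "z < n" "distinct [x, y, z]"
      using xs True by (auto simp: I_def)
    then have ne: "{x, y} \<noteq> {x, z}" by (auto simp: doubleton_eq_iff)
    define L where "L e = (if e = {x, y} then Some ` {4::nat..} else Some ` {3..})" for e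
    have "B xs = {g. \<forall>e\<in>{{x, y}, {x, z}}. g e \<in> L e}"
      using xyz ne by (auto simp: B_def L_def)
    also have "measure_pmf.prob (random_graph n q) \<dots> =
        (\<Prod>e\<in>{{x, y}, {x, z}}. measure_pmf.prob (label_pmf q) (L e))"
      using xyz by (intro prob_random_graph_labels) (auto simp: vertex_pairs_def)
    also have "\<dots> = P * (P + q 3)"
      using ne prob_label_in[OF q, of "{4..}"] prob_label_ge_3[OF q] by (simp add: L_def P)
    finally show ?thesis by simp
  qed
  have "measure_pmf.prob (random_graph n q) {g. \<not> isolated_big_edges {..<n} g}
      \<le> card I * (P * (P + q 3))"
    by (rule prob_union_bound[OF _ cover each]) (simp_all add: I_def finite_lists_length_eq)
  then show ?thesis by (simp add: I_def card_lists_length_eq)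
qed

lemma obtain_list_of_length:
  assumes "finite U" "U \<noteq> {}" "card U \<le> k"
  obtains xs where "set xs = U" "length xs = k"
proof -
  obtain ys where ys: "set ys = U" "distinct ys" using assms(1) finite_distinct_list by blast
  obtain u where "u \<in> U" using assms(2) by blast
  then show ?thesis
    using ys assms(3) distinct_card[OF ys(2)]
    by (intro that[of "ys @ replicate (k - length ys) u"]) auto
qed

text \<open>
  A set of at most \<open>k\<close> vertices that spans an edge is the set of entries of one of the \<open>n\<^sup>k\<close> lists of
  length \<open>k\<close>, padded by repetitions.  On such a set there are at most \<open>2 ^ 2 ^ k\<close> sets of pairs to consider;
  only the independence of this constant from \<open>n\<close> matters.
\<close>

lemma prob_not_few_three_edges:
  assumes q: "label_weights q" and "j > 0"
  shows "measure_pmf.prob (random_graph n q) {g. \<not> few_three_edges k j {..<n} g}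
    \<le> real n ^ k * (2 ^ 2 ^ k * q 3 ^ j)"
proof -
  define I where "I = {xs. set xs \<subseteq> {..<n} \<and> length xs = k}"
  have q3: "q 3 \<ge> 0" using q by (simp add: label_weights_def)
  have cover: "{g. \<not> few_three_edges k j {..<n} g} \<subseteq> (\<Union>xs\<in>I. {g. j \<le> card (three_edges g (set xs))})"
  proof
    fix g :: "nat edge_labelling" assume "g \<in> {g. \<not> few_three_edges k j {..<n} g}"
    then obtain U where U: "U \<subseteq> {..<n}" "card U \<le> k" "j \<le> card (three_edges g U)"
      by (auto simp: few_three_edges_def not_less)
    have "three_edges g {} = {}" by (auto simp: three_edges_def vertex_pairs_def)
    then have "U \<noteq> {}" using U(3) \<open>j > 0\<close> by auto
    moreover have "finite U" using U(1) finite_subset by blast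
    ultimately obtain xs where "set xs = U" "length xs = k"
      using U(2) obtain_list_of_length by blast
    then show "g \<in> (\<Union>xs\<in>I. {g. j \<le> card (three_edges g (set xs))})"
      using U by (auto simp: I_def)
  qed
  have each: "measure_pmf.prob (random_graph n q) {g. j \<le> card (three_edges g (set xs))}
      \<le> 2 ^ 2 ^ k * q 3 ^ j" if xs: "xs \<in> I" for xs
  proof -
    let ?V = "vertex_pairs (set xs)"
    define J where "J = {F. F \<subseteq> ?V \<and> card F = j}"
    have fin: "finite ?V" by (simp add: finite_vertex_pairs)
    have "card J \<le> card (Pow ?V)" using fin by (intro card_mono) (auto simp: J_def)
    also have "\<dots> = 2 ^ card ?V" using fin by (rule card_Pow)
    also have "card ?V \<le> card (Pow (set xs))" by (intro card_mono) (auto simp: vertex_pairs_def)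
    then have "(2::nat) ^ card ?V \<le> 2 ^ 2 ^ card (set xs)" by (simp add: card_Pow)
    also have "\<dots> \<le> 2 ^ 2 ^ k" using card_length[of xs] xs by (simp add: I_def)
    finally have J: "card J \<le> 2 ^ 2 ^ k" .
    have sub: "?V \<subseteq> vertex_pairs {..<n}" using xs by (auto simp: I_def vertex_pairs_def)
    have "measure_pmf.prob (random_graph n q) {g. j \<le> card (three_edges g (set xs))}
        \<le> card J * q 3 ^ j"
    proof (rule prob_union_bound)
      show "finite J" using fin by (simp add: J_def)
      show "{g. j \<le> card (three_edges g (set xs))} \<subseteq> (\<Union>F\<in>J. {g. \<forall>e\<in>F. g e \<in> Some ` {3}})"
      proof
        fix g assume "g \<in> {g. j \<le> card (three_edges g (set xs))}"
        then obtain F where "F \<subseteq> three_edges g (set xs)" "card F = j"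
          by (auto elim: obtain_subset_with_card_n)
        then show "g \<in> (\<Union>F\<in>J. {g. \<forall>e\<in>F. g e \<in> Some ` {3}})"
          by (auto simp: J_def three_edges_def)
      qed
      show "measure_pmf.prob (random_graph n q) {g. \<forall>e\<in>F. g e \<in> Some ` {3}} \<le> q 3 ^ j"
        if "F \<in> J" for F
        using that sub prob_label_in[OF q, of "{3}"]
        by (subst prob_random_graph_labels) (auto simp: J_def)
    qed
    also have "real (card J) \<le> real (2 ^ 2 ^ k)" using J by (simp only: of_nat_le_iff)
    then have "card J * q 3 ^ j \<le> 2 ^ 2 ^ k * q 3 ^ j"
      using q3 by (intro mult_right_mono) simp_all
    finally show ?thesis .
  qed
  have "measure_pmf.prob (random_graph n q) {g. \<not> few_three_edges k j {..<n} g}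
      \<le> card I * (2 ^ 2 ^ k * q 3 ^ j)"
    by (rule prob_union_bound[OF _ cover each]) (simp_all add: I_def finite_lists_length_eq)
  then show ?thesis by (simp add: I_def card_lists_length_eq)
qed

text \<open>
  The summands bound the probabilities of a big edge meeting an edge of label at least \<open>3\<close>, of a
  triangle with labels \<open>3\<close>, and of four edges labelled \<open>3\<close> on five vertices.
\<close>

lemma prob_not_FC_type:
  assumes q: "label_weights q" and P: "P = (\<Sum>\<^sub>\<infinity>m\<in>{4..}. q m)"
  shows "1 - measure_pmf.prob (random_graph n q) {g. FC_type {..<n} g}
    \<le> real n ^ 3 * (P * (P + q 3)) + real n ^ 3 * (2 ^ 2 ^ 3 * q 3 ^ 3)
      + real n ^ 5 * (2 ^ 2 ^ 5 * q 3 ^ 4)"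
proof -
  let ?M = "random_graph n q" and ?V = "{..<n}"
  let ?B1 = "{g. \<not> isolated_big_edges ?V g}" and ?B2 = "{g. \<not> few_three_edges 3 3 ?V g}"
    and ?B3 = "{g. \<not> few_three_edges 5 4 ?V g}"
  have "FC_type ?V g" if "g \<in> set_pmf ?M" "g \<notin> ?B1 \<union> ?B2 \<union> ?B3" for g
    using that random_graph_labels_ge_2[OF q that(1)]
    by (intro FC_type_if_sparse) (auto simp: sparse_def)
  then have "AE g in ?M. g \<in> - {g. FC_type ?V g} \<longrightarrow> g \<in> ?B1 \<union> ?B2 \<union> ?B3"
    unfolding AE_measure_pmf_iff by blast
  then have "measure_pmf.prob ?M (- {g. FC_type ?V g}) \<le> measure_pmf.prob ?M (?B1 \<union> ?B2 \<union> ?B3)"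
    by (intro measure_pmf.finite_measure_mono_AE) auto
  also have "\<dots> \<le> measure_pmf.prob ?M (?B1 \<union> ?B2) + measure_pmf.prob ?M ?B3"
    by (rule measure_subadditive) auto
  also have "measure_pmf.prob ?M (?B1 \<union> ?B2) \<le> measure_pmf.prob ?M ?B1 + measure_pmf.prob ?M ?B2"
    by (rule measure_subadditive) auto
  also note prob_not_isolated_big_edges[OF q P]
  also note prob_not_few_three_edges[OF q, of 3 n 3]
  also note prob_not_few_three_edges[OF q, of 4 n 5]
  finally have "measure_pmf.prob ?M (- {g. FC_type ?V g})
     \<le> real n ^ 3 * (P * (P + q 3)) + real n ^ 3 * (2 ^ 2 ^ 3 * q 3 ^ 3)
      + real n ^ 5 * (2 ^ 2 ^ 5 * q 3 ^ 4)" by simp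
  then show ?thesis
    using measure_pmf.prob_compl[of "{g. FC_type ?V g}" ?M] by (simp add: Compl_eq_Diff_UNIV)
qed

section \<open>The asymptotic statement\<close>

theorem theorem11:
  fixes p :: "nat \<Rightarrow> nat \<Rightarrow> real" and p\<^sub>B :: "nat \<Rightarrow> real"
  assumes nonneg: "\<And>n m. m \<ge> 2 \<Longrightarrow> p n m \<ge> 0"
    and summable: "\<And>n. (\<lambda>m. p n m) summable_on {2..}"
    and sum_le_1: "\<And>n. (\<Sum>\<^sub>\<infinity>m\<in>{2..}. p n m) \<le> 1"
    and p\<^sub>B: "\<And>n. p\<^sub>B n = (\<Sum>\<^sub>\<infinity>m\<in>{4..}. p n m)"
    and BB: "(\<lambda>n. real n ^ 3 * p\<^sub>B n ^ 2) \<longlonglongrightarrow> 0"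
    and B3: "(\<lambda>n. real n ^ 3 * p\<^sub>B n * p n 3) \<longlonglongrightarrow> 0"
    and A3: "(\<lambda>n. real n ^ 5 * p n 3 ^ 4) \<longlonglongrightarrow> 0"
  shows "(\<lambda>n. measure_pmf.prob (random_graph n (p n)) {g. FC_type {..<n} g}) \<longlonglongrightarrow> 1"
proof -
  let ?prob = "\<lambda>n. measure_pmf.prob (random_graph n (p n)) {g. FC_type {..<n} g}"
  define err where "err n = real n ^ 3 * (p\<^sub>B n * (p\<^sub>B n + p n 3))
    + real n ^ 3 * (2 ^ 2 ^ 3 * p n 3 ^ 3) + real n ^ 5 * (2 ^ 2 ^ 5 * p n 3 ^ 4)" for n
  have weights: "label_weights (p n)" for n
    using nonneg summable sum_le_1 by (simp add: label_weights_def)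
  \<comment> \<open>The triangle term \<open>(n p\<^sub>3)\<^sup>3\<close> is not among the hypotheses; it is controlled by
    \<open>(n p\<^sub>3)\<^sup>4 \<le> n\<^sup>5 p\<^sub>3\<^sup>4\<close>.\<close>
  have "(\<lambda>n. (real n * p n 3) ^ 4) \<longlonglongrightarrow> 0"
  proof (rule tendsto_sandwich[OF _ _ tendsto_const A3])
    show "\<forall>\<^sub>F n in sequentially. (real n * p n 3) ^ 4 \<le> real n ^ 5 * p n 3 ^ 4"
    proof (rule eventually_sequentiallyI)
      fix n :: nat assume "n \<ge> 1"
      then have "real n ^ 4 \<le> real n ^ 5" by (intro power_increasing) auto
      then show "(real n * p n 3) ^ 4 \<le> real n ^ 5 * p n 3 ^ 4"
        by (simp add: power_mult_distrib mult_right_mono)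
    qed
  qed simp
  then have "(\<lambda>n. real n * p n 3) \<longlonglongrightarrow> 0" by simp
  then have "(\<lambda>n. (real n * p n 3) ^ 3) \<longlonglongrightarrow> 0" by (intro tendsto_null_power) auto
  then have "(\<lambda>n. real n ^ 3 * p\<^sub>B n ^ 2 + real n ^ 3 * p\<^sub>B n * p n 3
      + 2 ^ 2 ^ 3 * (real n * p n 3) ^ 3 + 2 ^ 2 ^ 5 * (real n ^ 5 * p n 3 ^ 4))
      \<longlonglongrightarrow> 0 + 0 + 2 ^ 2 ^ 3 * 0 + 2 ^ 2 ^ 5 * 0"
    by (intro tendsto_add tendsto_mult tendsto_const BB B3 A3)
  then have "err \<longlonglongrightarrow> 0"
    by (simp add: err_def[abs_def] power_mult_distrib power2_eq_square algebra_simps)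
  then have lower: "(\<lambda>n. 1 - err n) \<longlonglongrightarrow> 1"
    using tendsto_diff[OF tendsto_const, of err 0 sequentially 1] by simp
  show ?thesis
  proof (rule tendsto_sandwich[OF _ _ lower tendsto_const])
    have "1 - err n \<le> ?prob n" for n
      using prob_not_FC_type[OF weights p\<^sub>B, of n n] unfolding err_def by linarith
    then show "\<forall>\<^sub>F n in sequentially. 1 - err n \<le> ?prob n" by simp
    show "\<forall>\<^sub>F n in sequentially. ?prob n \<le> 1" by simp
  qed
qed

end
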